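(* For every constant $c>0$, there exists a full-compatibility instance of the online allocation model with a common nonnegative, nondecreasing, discrete-concave bonus function $f$ (i.e. $f_i=f$ for all products $i$) such that $$\mathbb E[\mathrm{Rev}^{\mathrm{Greedy}}]<c\,\mathrm{OPT}_{\mathrm{on}}.$$ The claim holds even when the realized number of arrivals is deterministic.
   Context: Model. An instance consists of products $\mathcal I=\{1,\dots,m\}$, capacities $b_i\in\mathbb Z_+$, base rewards $r_i\ge 0$, bonus functions $f_i:\mathbb Z_+\to\mathbb R_+$ that are nonnegative and nondecreasing with $f_i(0)=0$, a horizon of $T$ periods and arrival probabilities $p_1,\dots,p_T\in[0,1]$. In period $t$ a customer arrives with probability $p_t$, independently across periods. Each arriving customer must be immediately and irrevocably assigned to a product with remaining capacity or rejected; every customer may be assigned to every product (full compatibility). The $k$-th sale of product $i$ yields reward $r_i+f_i(k)$. An online algorithm $\pi$ knows all parameters of the instance, but its decision in each period depends only on the arrivals observed so far, its past decisions and internal randomization independent of the arrivals. $\mathrm{Rev}^\pi$ is its random total reward and $\mathrm{OPT}_{\mathrm{on}}=\sup_\pi\mathbb E[\mathrm{Rev}^\pi]$ over all online algorithms. Discrete concavity of $f$: $f(k+1)-f(k)\le f(k)-f(k-1)$ for all $k\ge1$ in the relevant range (up to capacity). Myopic greedy: given current allocation $\boldsymbol x$, assign an arriving customer to some $i\in\arg\max_{j:\,x_j<b_j}\{r_j+f_j(x_j+1)\}$; if all products are sold out, reject the customer. *)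

theory Defs
  imports "HOL-Probability.Probability"
begin

record alloc_instance =
  num_products :: nat
  cap :: "nat \<Rightarrow> nat"
  base_reward :: "nat \<Rightarrow> real"
  bonus :: "nat \<Rightarrow> nat \<Rightarrow> real"
  horizon :: nat
  arrival_prob :: "nat \<Rightarrow> real"

definition products :: "alloc_instance \<Rightarrow> nat set" where
  "products I = {1..num_products I}"

definition valid_instance :: "alloc_instance \<Rightarrow> bool" where
  "valid_instance I \<longleftrightarrow>
     (\<forall>i\<in>products I. 0 \<le> base_reward I i \<and> bonus I i 0 = 0 \<and>
        (\<forall>k. 0 \<le> bonus I i k) \<and> mono (bonus I i)) \<and>
     (\<forall>t\<in>{1..horizon I}. 0 \<le> arrival_prob I t \<and> arrival_prob I t \<le> 1)"

definition discrete_concave_upto :: "nat \<Rightarrow> (nat \<Rightarrow> real) \<Rightarrow> bool" where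
  "discrete_concave_upto B f \<longleftrightarrow>
     (\<forall>k. 1 \<le> k \<and> k + 1 \<le> B \<longrightarrow> f (k + 1) - f k \<le> f k - f (k - 1))"

text \<open>An arrival sequence is a function \<open>a\<close>, where \<open>a t\<close> tells whether a customer arrives in
  period \<open>t \<in> {1..T}\<close>.\<close>

definition arrivals :: "alloc_instance \<Rightarrow> (nat \<Rightarrow> bool) pmf" where
  "arrivals I = Pi_pmf {1..horizon I} False (\<lambda>t. bernoulli_pmf (arrival_prob I t))"

definition num_arrivals :: "alloc_instance \<Rightarrow> (nat \<Rightarrow> bool) \<Rightarrow> nat" where
  "num_arrivals I a = card {t \<in> {1..horizon I}. a t}"

definition deterministic_num_arrivals :: "alloc_instance \<Rightarrow> bool" where
  "deterministic_num_arrivals I \<longleftrightarrow> (\<exists>n. AE a in arrivals I. num_arrivals I a = n)"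

text \<open>A policy draws a random seed, independently of the arrivals, and decides on the basis of the
  seed, the arrivals up to and including the current period, and its past decisions; \<open>None\<close> means
  that nothing is sold in the period. The seed may follow any probability law on any \<open>\<sigma>\<close>-algebra
  of reals; since each finite history admits finitely many feasible decisions and the horizon is
  finite, this is no restriction on the internal randomization.\<close>

record policy =
  seed :: "real measure"
  decide :: "real \<Rightarrow> bool list \<Rightarrow> nat option list \<Rightarrow> nat option"

fun decisions :: "policy \<Rightarrow> real \<Rightarrow> (nat \<Rightarrow> bool) \<Rightarrow> nat \<Rightarrow> nat option list" where
  "decisions \<pi> u a 0 = []"
| "decisions \<pi> u a (Suc t) =
     decisions \<pi> u a t @ [decide \<pi> u (map a [1..<Suc (Suc t)]) (decisions \<pi> u a t)]"

definition decision :: "policy \<Rightarrow> real \<Rightarrow> (nat \<Rightarrow> bool) \<Rightarrow> nat \<Rightarrow> nat option" where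
  "decision \<pi> u a t = decide \<pi> u (map a [1..<Suc t]) (decisions \<pi> u a (t - 1))"

text \<open>Number of units of product \<open>i\<close> sold in periods \<open>1, \<dots>, t\<close>.\<close>

definition sold :: "policy \<Rightarrow> real \<Rightarrow> (nat \<Rightarrow> bool) \<Rightarrow> nat \<Rightarrow> nat \<Rightarrow> nat" where
  "sold \<pi> u a t i = count_list (decisions \<pi> u a t) (Some i)"

definition available :: "alloc_instance \<Rightarrow> (nat \<Rightarrow> nat) \<Rightarrow> nat set" where
  "available I x = {j \<in> products I. x j < cap I j}"

definition online_policy :: "alloc_instance \<Rightarrow> policy \<Rightarrow> bool" where
  "online_policy I \<pi> \<longleftrightarrow>
     prob_space (seed \<pi>) \<and>
     (\<forall>h d. (\<lambda>u. decide \<pi> u h d) \<in> measurable (seed \<pi>) (count_space UNIV)) \<and>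
     (\<forall>u\<in>space (seed \<pi>). \<forall>a. \<forall>t\<in>{1..horizon I}. \<forall>i.
        decision \<pi> u a t = Some i \<longrightarrow> a t \<and> i \<in> available I (sold \<pi> u a (t - 1)))"

definition revenue :: "alloc_instance \<Rightarrow> policy \<Rightarrow> real \<Rightarrow> (nat \<Rightarrow> bool) \<Rightarrow> real" where
  "revenue I \<pi> u a =
     (\<Sum>i\<in>products I. \<Sum>k=1..sold \<pi> u a (horizon I) i. base_reward I i + bonus I i k)"

definition expected_revenue :: "alloc_instance \<Rightarrow> policy \<Rightarrow> real" where
  "expected_revenue I \<pi> =
     (\<integral>(u, a). revenue I \<pi> u a \<partial>(seed \<pi> \<Otimes>\<^sub>M measure_pmf (arrivals I)))"

definition opt_online :: "alloc_instance \<Rightarrow> real" where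
  "opt_online I = (SUP \<pi>\<in>{\<pi>. online_policy I \<pi>}. expected_revenue I \<pi>)"

text \<open>Ties may be broken arbitrarily, even at random or depending on the history.\<close>

definition myopic_greedy :: "alloc_instance \<Rightarrow> policy \<Rightarrow> bool" where
  "myopic_greedy I \<pi> \<longleftrightarrow> online_policy I \<pi> \<and>
     (\<forall>u\<in>space (seed \<pi>). \<forall>a. \<forall>t\<in>{1..horizon I}. a t \<longrightarrow>
        (let x = sold \<pi> u a (t - 1) in
          if available I x = {} then decision \<pi> u a t = None
          else \<exists>i. decision \<pi> u a t = Some i \<and>
                 is_arg_max (\<lambda>j. base_reward I j + bonus I j (x j + 1)) (\<lambda>j. j \<in> available I x) i))"


subsection \<open>Greedy policies exist, revenues are integrable, and the supremum is over a bounded set\<close>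

lemma decisions_Suc: "decisions \<pi> u a (Suc t) = decisions \<pi> u a t @ [decision \<pi> u a (Suc t)]"
  by (simp add: decision_def)

lemma sold_le_cap:
  assumes "online_policy I \<pi>" "u \<in> space (seed \<pi>)" "t \<le> horizon I"
  shows "sold \<pi> u a t i \<le> cap I i"
  using assms(3)
proof (induction t)
  case 0
  then show ?case by (simp add: sold_def)
next
  case (Suc t)
  have "decision \<pi> u a (Suc t) = Some i \<longrightarrow> i \<in> available I (sold \<pi> u a t)"
    using assms(1,2) Suc.prems unfolding online_policy_def
    by (metis One_nat_def Suc_leI atLeastAtMost_iff diff_Suc_1 zero_less_Suc)
  then show ?case
    using Suc by (auto simp: sold_def available_def decisions_Suc simp del: decisions.simps)
qed

lemma revenue_bounds:
  assumes "valid_instance I" "online_policy I \<pi>" "u \<in> space (seed \<pi>)"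
  shows "0 \<le> revenue I \<pi> u a"
    and "revenue I \<pi> u a \<le> (\<Sum>i\<in>products I. \<Sum>k=1..cap I i. base_reward I i + bonus I i k)"
proof -
  have nn: "0 \<le> base_reward I i + bonus I i k" if "i \<in> products I" for i k
    using assms(1) that by (auto simp: valid_instance_def)
  show "0 \<le> revenue I \<pi> u a"
    unfolding revenue_def by (intro sum_nonneg nn)
  show "revenue I \<pi> u a \<le> (\<Sum>i\<in>products I. \<Sum>k=1..cap I i. base_reward I i + bonus I i k)"
    unfolding revenue_def using sold_le_cap[OF assms(2,3) order.refl]
    by (intro sum_mono sum_mono2 nn) (auto intro: le_trans)
qed

lemma measurable_decisions:
  assumes "\<And>h d. (\<lambda>u. decide \<pi> u h d) \<in> measurable (seed \<pi>) (count_space UNIV)"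
  shows "(\<lambda>(u, a). decisions \<pi> u a t) \<in>
    measurable (seed \<pi> \<Otimes>\<^sub>M measure_pmf P) (count_space UNIV)"
proof (induction t)
  case 0
  then show ?case by simp
next
  case (Suc t)
  let ?M = "seed \<pi> \<Otimes>\<^sub>M measure_pmf P"
  have h: "(\<lambda>w. map (snd w) [1..<Suc (Suc t)]) \<in> measurable ?M (count_space UNIV)"
    by (rule measurable_compose[OF measurable_snd]) simp
  have d: "(\<lambda>w. decide \<pi> (fst w) h d) \<in> measurable ?M (count_space UNIV)" for h d
    by (rule measurable_compose[OF measurable_fst assms])
  have D: "(\<lambda>w. decisions \<pi> (fst w) (snd w) t) \<in> measurable ?M (count_space UNIV)"
    using Suc by (simp add: case_prod_beta')
  have e: "(\<lambda>w. d @ [decide \<pi> (fst w) h d]) \<in> measurable ?M (count_space UNIV)" for h d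
    by (rule measurable_compose[OF d]) simp
  have e': "(\<lambda>w. d @ [decide \<pi> (fst w) (map (snd w) [1..<Suc (Suc t)]) d])
      \<in> measurable ?M (count_space UNIV)" for d
    by (rule measurable_compose_countable[OF e[where d = d] h])
  show ?case
    using measurable_compose_countable[OF e' D] by (simp add: case_prod_beta')
qed

lemma integrable_revenue:
  assumes "valid_instance I" "online_policy I \<pi>"
  shows "integrable (seed \<pi> \<Otimes>\<^sub>M measure_pmf (arrivals I)) (\<lambda>(u, a). revenue I \<pi> u a)"
proof -
  let ?M = "seed \<pi> \<Otimes>\<^sub>M measure_pmf (arrivals I)"
  interpret S: prob_space "seed \<pi>" using assms(2) by (simp add: online_policy_def)
  interpret pair_prob_space "seed \<pi>" "measure_pmf (arrivals I)" ..
  have "(\<lambda>w. case w of (u, a) \<Rightarrow> decisions \<pi> u a (horizon I)) \<in> measurable ?M (count_space UNIV)"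
    by (rule measurable_decisions) (use assms(2) in \<open>simp add: online_policy_def\<close>)
  then have "(\<lambda>w. (\<lambda>d. \<Sum>i\<in>products I. \<Sum>k=1..count_list d (Some i).
      base_reward I i + bonus I i k) (case w of (u, a) \<Rightarrow> decisions \<pi> u a (horizon I)))
      \<in> borel_measurable ?M"
    by (rule measurable_compose) simp
  then have m: "(\<lambda>(u, a). revenue I \<pi> u a) \<in> borel_measurable ?M"
    by (simp add: revenue_def sold_def case_prod_beta')
  show ?thesis
    by (rule integrable_const_bound[OF _ m,
          of "\<Sum>i\<in>products I. \<Sum>k=1..cap I i. base_reward I i + bonus I i k"])
       (use revenue_bounds[OF assms] in \<open>auto simp: space_pair_measure intro!: AE_I2\<close>)
qed

lemma bdd_above_expected_revenue:
  assumes "valid_instance I"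
  shows "bdd_above (expected_revenue I ` {\<pi>. online_policy I \<pi>})"
proof (rule bdd_aboveI2)
  fix \<pi> assume "\<pi> \<in> {\<pi>. online_policy I \<pi>}"
  then have \<pi>: "online_policy I \<pi>" by simp
  interpret S: prob_space "seed \<pi>" using \<pi> by (simp add: online_policy_def)
  interpret pair_prob_space "seed \<pi>" "measure_pmf (arrivals I)" ..
  show "expected_revenue I \<pi> \<le> (\<Sum>i\<in>products I. \<Sum>k=1..cap I i. base_reward I i + bonus I i k)"
    unfolding expected_revenue_def
    by (rule integral_le_const[OF integrable_revenue[OF assms \<pi>]])
       (use revenue_bounds[OF assms \<pi>] in \<open>auto simp: space_pair_measure intro!: AE_I2\<close>)
qed

lemma ex_myopic_greedy: "\<exists>\<pi>. myopic_greedy I \<pi>"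
proof -
  define g where "g x = (if available I x = {} then None else
      Some (arg_max (\<lambda>j. base_reward I j + bonus I j (x j + 1)) (\<lambda>j. j \<in> available I x)))" for x
  define \<pi> where "\<pi> = \<lparr>seed = return borel 0,
      decide = (\<lambda>u h d. if last h then g (\<lambda>i. count_list d (Some i)) else None)\<rparr>"
  have fin: "finite (available I x)" for x
    by (simp add: available_def products_def)
  have am: "is_arg_max (\<lambda>j. base_reward I j + bonus I j (x j + 1)) (\<lambda>j. j \<in> available I x)
      (arg_max (\<lambda>j. base_reward I j + bonus I j (x j + 1)) (\<lambda>j. j \<in> available I x))"
    if ne: "available I x \<noteq> {}" for x
  proof -
    let ?f = "\<lambda>j. base_reward I j + bonus I j (x j + 1)"
    have "Max (?f ` available I x) \<in> ?f ` available I x"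
      by (rule Max_in) (use fin ne in auto)
    then obtain j where j: "j \<in> available I x" "?f j = Max (?f ` available I x)"
      by (metis (no_types, lifting) imageE)
    have "is_arg_max ?f (\<lambda>j. j \<in> available I x) j"
      unfolding is_arg_max_linorder j(2) using j(1) fin by (auto intro: Max_ge)
    then show ?thesis
      unfolding arg_max_def by (rule someI)
  qed
  have dec: "decision \<pi> u a t = (if a t then g (sold \<pi> u a (t - 1)) else None)"
    if "1 \<le> t" for u a t
  proof -
    have "last (map a [1..<Suc t]) = a t" using that by (simp add: last_map)
    then show ?thesis by (simp add: decision_def sold_def[abs_def] \<pi>_def)
  qed
  have on: "online_policy I \<pi>"
    unfolding online_policy_def
  proof (intro conjI ballI allI impI)
    show "prob_space (seed \<pi>)" by (simp add: \<pi>_def prob_space_return)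
    show "(\<lambda>u. decide \<pi> u h d) \<in> measurable (seed \<pi>) (count_space UNIV)" for h d
      by (simp add: \<pi>_def)
    fix u a t i assume t: "t \<in> {1..horizon I}" and e: "decision \<pi> u a t = Some i"
    show "a t" using t e by (auto simp: dec split: if_splits)
    show "i \<in> available I (sold \<pi> u a (t - 1))"
      using t e am unfolding is_arg_max_def by (auto simp: dec g_def split: if_splits)
  qed
  have "myopic_greedy I \<pi>"
    unfolding myopic_greedy_def Let_def using on am by (auto simp: dec g_def)
  then show ?thesis ..
qed

end

theory Submission
  imports Defs
begin

text \<open>With the bonus \<open>f k = k\<close>, take one product of base reward \<open>0\<close> and capacity \<open>n\<close>, and \<open>n\<close>
  decoys of base reward \<open>1\<close> and capacity \<open>1\<close>, with \<open>n\<close> certain arrivals. A fresh decoy pays \<open>2\<close>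
  while the first unit of the large product pays \<open>1\<close>, so greedy sells only decoys and earns at most
  \<open>2 n\<close>. Always selling the large product earns \<open>1 + \<dots> + n\<close>.\<close>

definition decoy_instance :: "nat \<Rightarrow> alloc_instance" where
  "decoy_instance n = \<lparr>num_products = Suc n,
     cap = (\<lambda>i. if i = Suc n then n else 1),
     base_reward = (\<lambda>i. if i = Suc n then 0 else 1),
     bonus = (\<lambda>_. real), horizon = n, arrival_prob = (\<lambda>_. 1)\<rparr>"

lemma decoy_instance_simps [simp]:
  "products (decoy_instance n) = {1..Suc n}"
  "cap (decoy_instance n) i = (if i = Suc n then n else 1)"
  "base_reward (decoy_instance n) i = (if i = Suc n then 0 else 1)"
  "bonus (decoy_instance n) i = real"
  "horizon (decoy_instance n) = n"
  "arrival_prob (decoy_instance n) t = 1"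
  by (simp_all add: decoy_instance_def products_def)

lemma valid_decoy_instance: "valid_instance (decoy_instance n)"
  by (simp add: valid_instance_def mono_def)

lemma arrivals_decoy_instance: "arrivals (decoy_instance n) = return_pmf (\<lambda>t. t \<in> {1..n})"
proof -
  have "bernoulli_pmf 1 = return_pmf True"
    by (rule pmf_eqI) (simp add: indicator_def)
  then show ?thesis
    by (simp add: arrivals_def Pi_pmf_return_pmf if_bool_eq_conj)
qed

lemma deterministic_decoy_instance: "deterministic_num_arrivals (decoy_instance n)"
  by (simp add: deterministic_num_arrivals_def arrivals_decoy_instance AE_measure_pmf_iff)

lemma length_decisions [simp]: "length (decisions \<pi> u a t) = t"
  by (induction t) auto

text \<open>Pigeonhole: \<open>t\<close> periods hold \<open>t\<close> decisions, each naming at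
  most one product, so more than \<open>t\<close> products cannot all have been sold.\<close>

lemma ex_unsold:
  assumes "t < card A"
  obtains i where "i \<in> A" "sold \<pi> u a t i = 0"
proof -
  have "\<not> Some ` A \<subseteq> set (decisions \<pi> u a t)"
  proof
    assume "Some ` A \<subseteq> set (decisions \<pi> u a t)"
    then have "card A \<le> card (set (decisions \<pi> u a t))"
      by (metis List.finite_set card_image card_mono inj_Some)
    also have "\<dots> \<le> t"
      using card_length[of "decisions \<pi> u a t"] by simp
    finally show False
      using assms by simp
  qed
  then show thesis
    using that by (auto simp: sold_def count_list_0_iff)
qed

text \<open>While the large product is unsold its next unit pays only 1, and fewer than
  \<open>n\<close> past periods leave some decoy paying 2. The gap is strict, so no tie-breaking
  rule can select the large product.\<close>

lemma greedy_avoids_large_product: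
  assumes greedy: "myopic_greedy (decoy_instance n) \<pi>" and u: "u \<in> space (seed \<pi>)" and "t \<le> n"
  shows "sold \<pi> u a t (Suc n) = 0"
  using assms(3)
proof (induction t)
  case 0
  then show ?case by (simp add: sold_def)
next
  case (Suc t)
  let ?I = "decoy_instance n" and ?x = "sold \<pi> u a t"
  have t: "Suc t \<in> {1..horizon ?I}" using Suc.prems by simp
  have IH: "?x (Suc n) = 0" using Suc by simp
  have "decision \<pi> u a (Suc t) \<noteq> Some (Suc n)"
  proof
    assume d: "decision \<pi> u a (Suc t) = Some (Suc n)"
    obtain i where i: "i \<in> {1..n}" "?x i = 0"
      using Suc.prems ex_unsold[of t "{1..n}"] by (metis Suc_le_lessD card_atLeastAtMost diff_Suc_1)
    then have av: "i \<in> available ?I ?x"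
      by (auto simp: available_def)
    \<comment> \<open>The greedy rule binds only in periods with an arrival; feasibility of the sale
      supplies that arrival.\<close>
    have "a (Suc t)"
      using greedy u t d unfolding myopic_greedy_def online_policy_def by blast
    then have "is_arg_max (\<lambda>j. base_reward ?I j + bonus ?I j (?x j + 1))
        (\<lambda>j. j \<in> available ?I ?x) (Suc n)"
      using greedy u t d av unfolding myopic_greedy_def Let_def
      by (auto dest!: bspec[where x = u] bspec[where x = "Suc t"] spec[where x = a]
               split: if_splits)
    then show False
      using av i IH by (auto simp: is_arg_max_linorder dest!: spec[where x = i])
  qed
  then show ?case
    using IH by (simp add: sold_def decisions_Suc del: decisions.simps)
qed

text \<open>The large product contributes nothing, and capacity 1 limits each of the
  \<open>n\<close> decoys to a single reward of 1 + 1.\<close>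

lemma greedy_revenue_le:
  assumes greedy: "myopic_greedy (decoy_instance n) \<pi>" and u: "u \<in> space (seed \<pi>)"
  shows "revenue (decoy_instance n) \<pi> u a \<le> 2 * real n"
proof -
  let ?I = "decoy_instance n"
  have \<pi>: "online_policy ?I \<pi>" using greedy by (simp add: myopic_greedy_def)
  have "(\<Sum>k=1..sold \<pi> u a n i. 1 + real k) \<le> 2" if "i \<in> {1..n}" for i
  proof -
    have "sold \<pi> u a n i \<le> 1"
      using sold_le_cap[OF \<pi> u, of n a i] that by simp
    then show ?thesis
      by (cases "sold \<pi> u a n i") auto
  qed
  then have "(\<Sum>i=1..n. \<Sum>k=1..sold \<pi> u a n i. 1 + real k) \<le> (\<Sum>i=1..n. 2)"
    by (rule sum_mono)
  moreover have "revenue ?I \<pi> u a = (\<Sum>i=1..n. \<Sum>k=1..sold \<pi> u a n i. 1 + real k)"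
    using greedy_avoids_large_product[OF assms order.refl, of a] by (simp add: revenue_def)
  ultimately show ?thesis by simp
qed

lemma greedy_expected_revenue_le:
  assumes "myopic_greedy (decoy_instance n) \<pi>"
  shows "expected_revenue (decoy_instance n) \<pi> \<le> 2 * real n"
proof -
  let ?I = "decoy_instance n"
  have \<pi>: "online_policy ?I \<pi>" using assms by (simp add: myopic_greedy_def)
  interpret S: prob_space "seed \<pi>" using \<pi> by (simp add: online_policy_def)
  interpret pair_prob_space "seed \<pi>" "measure_pmf (arrivals ?I)" ..
  show ?thesis
    unfolding expected_revenue_def
    by (rule integral_le_const[OF integrable_revenue[OF valid_decoy_instance \<pi>]])
       (use greedy_revenue_le[OF assms] in \<open>auto simp: space_pair_measure intro!: AE_I2\<close>)
qed

definition always_sell :: "nat \<Rightarrow> policy" where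
  "always_sell i = \<lparr>seed = return borel 0, decide = (\<lambda>u h d. if last h then Some i else None)\<rparr>"

text \<open>Periods start at 1, so the observed history is nonempty and its last entry is the
  current arrival.\<close>

lemma decision_always_sell:
  "decision (always_sell i) u a (Suc t) = (if a (Suc t) then Some i else None)"
  by (simp add: decision_def always_sell_def last_map)

text \<open>The policy never checks capacity, but before any period up to \<open>n\<close> fewer
  than \<open>n\<close> units have been sold.\<close>

lemma online_always_sell: "online_policy (decoy_instance n) (always_sell (Suc n))"
  unfolding online_policy_def
proof (intro conjI ballI allI impI)
  let ?\<pi> = "always_sell (Suc n)"
  show "prob_space (seed ?\<pi>)"
    by (simp add: always_sell_def prob_space_return)
  show "(\<lambda>u. decide ?\<pi> u h d) \<in> measurable (seed ?\<pi>) (count_space UNIV)" for h d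
    by (simp add: always_sell_def)
  fix u a t i
  assume t: "t \<in> {1..horizon (decoy_instance n)}" and d: "decision ?\<pi> u a t = Some i"
  obtain s where s: "t = Suc s" "s < n"
    using t by (cases t) auto
  show "a t"
    using d s by (simp add: decision_always_sell split: if_splits)
  have "i = Suc n"
    using d s by (simp add: decision_always_sell split: if_splits)
  moreover have "sold ?\<pi> u a s (Suc n) < n"
    unfolding sold_def using count_le_length[of "decisions ?\<pi> u a s"] s
    by (metis length_decisions le_less_trans)
  ultimately show "i \<in> available (decoy_instance n) (sold ?\<pi> u a (t - 1))"
    using s by (simp add: available_def)
qed

lemma expected_revenue_always_sell:
  "expected_revenue (decoy_instance n) (always_sell (Suc n)) = real n * (real n + 1) / 2"
proof -
  let ?I = "decoy_instance n" and ?\<pi> = "always_sell (Suc n)" and ?a = "\<lambda>t. t \<in> {1..n}"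
  interpret S: prob_space "seed ?\<pi>"
    using online_always_sell by (simp add: online_policy_def)
  interpret pair_prob_space "seed ?\<pi>" "measure_pmf (arrivals ?I)" ..
  have "sold ?\<pi> u ?a t i = (if i = Suc n then t else 0)" if "t \<le> n" for u t i
    using that
    by (induction t)
       (auto simp: sold_def decisions_Suc decision_always_sell simp del: decisions.simps(2))
  then have "revenue ?I ?\<pi> u ?a = (\<Sum>k=1..n. real k)" for u
    by (simp add: revenue_def)
  also have "(\<Sum>k=1..n. real k) = real n * (real n + 1) / 2"
    by (induction n) (simp_all add: field_simps)
  finally have "revenue ?I ?\<pi> u ?a = real n * (real n + 1) / 2" for u .
  then have inner: "(\<integral>a. revenue ?I ?\<pi> u a \<partial>measure_pmf (arrivals ?I)) = real n * (real n + 1) / 2" for u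
    by (simp add: arrivals_decoy_instance)
  \<comment> \<open>Fubini separates seed and arrivals; the inner integral is over a point mass and
    does not depend on the seed.\<close>
  have "expected_revenue ?I ?\<pi> =
      (\<integral>u. (\<integral>a. revenue ?I ?\<pi> u a \<partial>measure_pmf (arrivals ?I)) \<partial>seed ?\<pi>)"
    using integral_fst'[OF integrable_revenue[OF valid_decoy_instance online_always_sell]]
    by (simp add: expected_revenue_def)
  then show ?thesis
    unfolding inner by (simp add: S.prob_space)
qed

theorem proposition4:
  fixes c :: real
  assumes "c > 0"
  shows "\<exists>I f. valid_instance I \<and>
      (\<forall>i\<in>products I. bonus I i = f \<and> discrete_concave_upto (cap I i) f) \<and>
      deterministic_num_arrivals I \<and>
      (\<forall>\<pi>. myopic_greedy I \<pi> \<longrightarrow> expected_revenue I \<pi> < c * opt_online I)"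
proof -
  \<comment> \<open>The ratio of \<open>2 * n\<close> to \<open>n * (n + 1) / 2\<close> is
    \<open>4 / (n + 1)\<close>, which this choice pushes below \<open>c\<close>.\<close>
  obtain n :: nat where n: "4 / c < real n"
    using reals_Archimedean2 by blast
  let ?I = "decoy_instance n"
  have "0 < n"
    using n assms by (cases n) (auto simp: field_simps)
  \<comment> \<open>Linear bonuses have constant increments, so concavity holds with
    equality.\<close>
  have "discrete_concave_upto k real" for k
    by (auto simp: discrete_concave_upto_def of_nat_diff)
  moreover have "expected_revenue ?I \<pi> < c * opt_online ?I" if "myopic_greedy ?I \<pi>" for \<pi>
  proof -
    have "4 < c * (real n + 1)"
      using n assms by (simp add: field_simps)
    then have "4 * (real n / 2) < c * (real n + 1) * (real n / 2)"
      using \<open>0 < n\<close> by (intro mult_strict_right_mono) auto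
    then have "2 * real n < c * (real n * (real n + 1) / 2)"
      by (simp add: algebra_simps)
    \<comment> \<open>Selling only the large product is one competitor in the supremum; boundedness
      above makes the real-valued \<open>SUP\<close> dominate it.\<close>
    also have "\<dots> \<le> c * opt_online ?I"
      unfolding opt_online_def expected_revenue_always_sell[symmetric] using assms
      by (intro mult_left_mono cSUP_upper bdd_above_expected_revenue valid_decoy_instance)
         (simp_all add: online_always_sell)
    finally show ?thesis
      using greedy_expected_revenue_le[OF that] by simp
  qed
  ultimately show ?thesis
    using valid_decoy_instance deterministic_decoy_instance
    by (intro exI[of _ ?I] exI[of _ real]) auto
qed

end
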